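(* Let $p$ be a prime with $p\equiv 2$ or $3\pmod 5$ and let $r$ be a positive integer. Let $\Gamma_p(r,2)$ be the graph whose vertices are the subspaces belonging to $G_p(r,2)$, two vertices $A$ and $B$ being adjacent if and only if $\dim(A\cap B)=0$. Then $\Gamma_p(r,2)$ is a complete graph with $\dfrac{p^{2r+2}-1}{p^2-1}$ vertices.
   Context: Fix $\omega \in \mathbb{F}_{p^2}$ such that $\{1,\omega\}$ is an $\mathbb{F}_p$-basis of $\mathbb{F}_{p^2}$. For each positive integer $i$ the map $\phi_O:\mathbb{F}_{p^2}^i\to M_{2\times 2i}(\mathbb{F}_p)$ is defined, for $c_j,d_j\in\mathbb{F}_p$, by $$\phi_O((c_1+d_1\omega,\dots,c_i+d_i\omega))=\begin{pmatrix} d_1&c_1&d_2&c_2&\cdots&d_i&c_i\\ c_1+d_1&d_1&c_2+d_2&d_2&\cdots&c_i+d_i&d_i\end{pmatrix}.$$ $\langle M\rangle$ denotes the row space of a matrix $M$. For $1\le i\le r$ let $$D_i=\left\{\left\langle\begin{pmatrix}0_{2\times(2r-2i)} & I_2 & A\end{pmatrix}\right\rangle : A\in\phi_O(\mathbb{F}_{p^2}^i)\right\},$$ a set of subspaces of $\mathbb{F}_p^{2r+2}$, let $\widehat H_2=(0_{2\times 2r}\ \ I_2)$, and define $G_p(r,2)=\{\langle\widehat H_2\rangle\}\cup\bigcup_{i=1}^r D_i$. A complete graph is a simple graph in which each pair of distinct vertices is joined by an edge. *)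

theory Defs
  imports
    "Berlekamp_Zassenhaus.Finite_Field"
    "Jordan_Normal_Form.VS_Connect"
    "Graph_Theory.Kuratowski"
begin

text \<open>The prime field is \<^typ>\<open>'p mod_ring\<close> with \<open>p = CARD('p)\<close>. A field with \<open>p\<^sup>2\<close> elements has
  characteristic \<open>p\<close>, so it contains the prime field in exactly one way, via \<open>gf_emb\<close>.\<close>

definition gf_emb :: "'p::prime_card mod_ring \<Rightarrow> 'f::field" where
  "gf_emb c = of_int (to_int_mod_ring c)"

definition gf_scale :: "'p::prime_card mod_ring \<Rightarrow> 'f::field \<Rightarrow> 'f" where
  "gf_scale c x = gf_emb c * x"

lemma CHAR_eq_of_CARD:
  assumes "CARD('f::field) = CARD('p::prime_card) ^ 2"
  shows "CHAR('f) = CARD('p)"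
proof -
  have p: "prime CARD('p)" by (rule prime_card)
  have fin: "finite (UNIV :: 'f set)"
    using assms p by (intro card_ge_0_finite) (simp add: prime_gt_0_nat)
  have "CHAR('f) dvd CARD('p) ^ 2"
    using CHAR_dvd_CARD[where 'a = 'f] assms by simp
  moreover have "prime CHAR('f)"
    using fin by (intro prime_CHAR_semidom finite_imp_CHAR_pos)
  ultimately show ?thesis
    using p by (metis prime_dvd_power primes_dvd_imp_eq)
qed

lemma vector_space_gf_scale:
  assumes "CARD('f::field) = CARD('p::prime_card) ^ 2"
  shows "vector_space (gf_scale :: 'p mod_ring \<Rightarrow> 'f \<Rightarrow> 'f)"
proof -
  have char: "CHAR('f) = CARD('p)" by (rule CHAR_eq_of_CARD[OF assms])
  have red: "(of_int (n mod int CARD('p)) :: 'f) = of_int n" for n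
    by (rule of_int_eq_iff_cong_CHAR[THEN iffD2]) (simp add: char cong_def)
  have add: "gf_emb (a + b) = (gf_emb a + gf_emb b :: 'f)" for a b :: "'p mod_ring"
    unfolding gf_emb_def to_int_mod_ring.rep_eq plus_mod_ring.rep_eq red by simp
  have mult: "gf_emb (a * b) = (gf_emb a * gf_emb b :: 'f)" for a b :: "'p mod_ring"
    unfolding gf_emb_def to_int_mod_ring.rep_eq times_mod_ring.rep_eq red by simp
  have one: "gf_emb (1 :: 'p mod_ring) = (1 :: 'f)"
    by (simp add: gf_emb_def)
  show ?thesis
    by unfold_locales (auto simp: gf_scale_def add mult one algebra_simps)
qed

definition gf_basis :: "'p::prime_card itself \<Rightarrow> 'f::field set \<Rightarrow> bool" where
  "gf_basis _ B \<longleftrightarrow>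
    \<not> Modules.module.dependent (gf_scale :: 'p mod_ring \<Rightarrow> 'f \<Rightarrow> 'f) B \<and>
    Modules.module.span (gf_scale :: 'p mod_ring \<Rightarrow> 'f \<Rightarrow> 'f) B = UNIV"

text \<open>\<open>gf_coord \<omega> x b\<close> is the coefficient of \<open>x\<close> at the element \<open>b\<close> of the basis \<open>{1, \<omega>}\<close>.\<close>

definition gf_coord :: "'f::field \<Rightarrow> 'f \<Rightarrow> 'f \<Rightarrow> 'p::prime_card mod_ring" where
  "gf_coord \<omega> x b = Modules.module.representation gf_scale {1, \<omega>} x b"

definition phi_O :: "'f::field \<Rightarrow> 'f vec \<Rightarrow> 'p::prime_card mod_ring mat" where
  "phi_O \<omega> x = mat 2 (2 * dim_vec x) (\<lambda>(a, b).
     let c = gf_coord \<omega> (x $ (b div 2)) 1;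
         d = gf_coord \<omega> (x $ (b div 2)) \<omega>
     in if a = 0 then (if even b then d else c)
                 else (if even b then c + d else d))"

definition hcat :: "'a::zero mat \<Rightarrow> 'a mat \<Rightarrow> 'a mat" where
  "hcat A B = four_block_mat A B (0\<^sub>m 0 (dim_col A)) (0\<^sub>m 0 (dim_col B))"

definition subspace_dim :: "nat \<Rightarrow> 'a::field vec set \<Rightarrow> nat" where
  "subspace_dim n W = vectorspace.dim class_ring ((module_vec TYPE('a) n)\<lparr>carrier := W\<rparr>)"

definition D_set :: "'f::field \<Rightarrow> nat \<Rightarrow> nat \<Rightarrow> 'p::prime_card mod_ring vec set set" where
  "D_set \<omega> r i =
    {vec_space.row_space (2 * r + 2) (hcat (0\<^sub>m 2 (2 * r - 2 * i)) (hcat (1\<^sub>m 2) A)) | A.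
      A \<in> phi_O \<omega> ` carrier_vec i}"

definition H2 :: "nat \<Rightarrow> 'p::prime_card mod_ring mat" where
  "H2 r = hcat (0\<^sub>m 2 (2 * r)) (1\<^sub>m 2)"

definition G_set :: "'f::field \<Rightarrow> nat \<Rightarrow> 'p::prime_card mod_ring vec set set" where
  "G_set \<omega> r = {vec_space.row_space (2 * r + 2) (H2 r)} \<union> (\<Union>i\<in>{1..r}. D_set \<omega> r i)"

text \<open>An undirected graph is a symmetric digraph; an edge is a pair of opposite arcs. Loops are not
  excluded by hand.\<close>

definition Gamma_graph :: "'f::field \<Rightarrow> nat \<Rightarrow> 'p::prime_card mod_ring vec set pair_pre_digraph" where
  "Gamma_graph \<omega> r =
    \<lparr>pverts = G_set \<omega> r,
     parcs = {(A, B). A \<in> G_set \<omega> r \<and> B \<in> G_set \<omega> r \<and> subspace_dim (2 * r + 2) (A \<inter> B) = 0}\<rparr>"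

text \<open>\<open>gf_coord\<close> recovers \<open>c\<close> and \<open>d\<close> from \<open>c + d \<omega>\<close>.\<close>

lemma gf_coord_eq:
  fixes c d :: "'p::prime_card mod_ring" and \<omega> :: "'f::field"
  assumes card: "CARD('f) = CARD('p) ^ 2" and basis: "gf_basis TYPE('p) {1, \<omega>}"
  shows "gf_coord \<omega> (gf_emb c + gf_emb d * \<omega>) 1 = c"
    and "gf_coord \<omega> (gf_emb c + gf_emb d * \<omega>) \<omega> = d"
proof -
  interpret F: vector_space "gf_scale :: 'p mod_ring \<Rightarrow> 'f \<Rightarrow> 'f"
    by (rule vector_space_gf_scale[OF card])
  have ind: "F.independent {1, \<omega>}" and span: "F.span {1, \<omega>} = UNIV"
    using basis by (auto simp: gf_basis_def)
  have "\<omega> \<noteq> 1"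
  proof
    assume "\<omega> = 1"
    with span have "(UNIV :: 'f set) = range (\<lambda>k :: 'p mod_ring. gf_scale k 1)"
      by (simp add: F.span_singleton)
    then have "CARD('f) \<le> CARD('p mod_ring)"
      by (metis card_image_le finite)
    with card prime_gt_1_nat[OF prime_card[where 'a = 'p]] show False
      by (simp add: power2_eq_square)
  qed
  define f :: "'f \<Rightarrow> 'p mod_ring"
    where "f = (\<lambda>v. if v = 1 then c else if v = \<omega> then d else 0)"
  have sub: "{v. f v \<noteq> 0} \<subseteq> {1, \<omega>}" by (auto simp: f_def)
  have fin: "finite {v. f v \<noteq> 0}" by (rule finite_subset[OF sub]) simp
  have "(\<Sum>v | f v \<noteq> 0. gf_scale (f v) v) = (\<Sum>v\<in>{1, \<omega>}. gf_scale (f v) v)"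
    by (rule sum.mono_neutral_left) (use sub in auto)
  also have "\<dots> = gf_emb c + gf_emb d * \<omega>"
    using \<open>\<omega> \<noteq> 1\<close> by (simp add: f_def gf_scale_def)
  finally have "F.representation {1, \<omega>} (gf_emb c + gf_emb d * \<omega>) = f"
    using sub fin span by (intro F.representation_eqI ind) auto
  then show "gf_coord \<omega> (gf_emb c + gf_emb d * \<omega>) 1 = c"
    "gf_coord \<omega> (gf_emb c + gf_emb d * \<omega>) \<omega> = d"
    using \<open>\<omega> \<noteq> 1\<close> by (auto simp: gf_coord_def f_def)
qed

end

theory Submission
  imports Defs "HOL-Number_Theory.Number_Theory"
begin

text \<open>By quadratic reciprocity, 5 is not a square modulo \<open>p\<close> (and \<open>x\<^sup>2 + x + 1\<close> is irreducible modulo 2),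
  so every nonzero matrix in the image of \<open>phi_O\<close> on scalars, whose determinant is
  \<open>d\<^sup>2 - c d - c\<^sup>2\<close>, is invertible. A common vector of two spaces with identity blocks at
  different positions vanishes on the leftmost of these blocks, hence is zero; if the blocks are at the
  same position, it is a common multiple \<open>u\<close> of both generator matrices with \<open>u (A - B) = 0\<close>, and
  one invertible block of \<open>A - B\<close> forces \<open>u = 0\<close>. Hence the spaces are distinct, and there is one
  for each vector over \<open>'f\<close> of length at most \<open>r\<close>.\<close>

section \<open>The form d^2 - c d - c^2 and the quadratic character of 5\<close>

text \<open>The squares modulo 5 are 0, 1 and 4, so \<open>p\<close> is a nonresidue modulo 5.
  Reciprocity then carries this over without a sign, because (5 - 1) / 2 is even.\<close>

lemma not_QuadRes_5:
  assumes p: "prime p" "2 < p" and mod5: "[p = 2] (mod 5) \<or> [p = 3] (mod 5)"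
  shows "\<not> QuadRes (int p) 5"
proof -
  have pm: "p mod 5 = 2 \<or> p mod 5 = 3" using mod5 by (simp add: cong_def)
  then have "p \<noteq> 5" by auto
  have ip: "int p mod 5 = 2 \<or> int p mod 5 = 3" using pm by presburger
  have nq: "\<not> QuadRes 5 (int p)"
  proof
    assume "QuadRes 5 (int p)"
    then obtain y :: int where y: "y^2 mod 5 = int p mod 5" by (auto simp: QuadRes_def cong_def)
    have "y^2 mod 5 = (y mod 5)^2 mod 5" by (simp add: power_mod)
    moreover have "y mod 5 \<in> {0,1,2,3,4}" by auto
    ultimately show False using y ip by auto
  qed
  have "Legendre (int p) 5 = -1"
    using nq ip by (auto simp: Legendre_def cong_def)
  moreover have "Legendre (int p) (int 5) * Legendre (int 5) (int p) = (-1) ^ ((p - 1) div 2 * ((5 - 1) div 2))"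
    using p \<open>p \<noteq> 5\<close> by (intro Quadratic_Reciprocity) auto
  moreover have "(-1::int) ^ ((p - 1) div 2 * ((5 - 1) div 2)) = 1" by simp
  ultimately have "Legendre 5 (int p) = -1" by simp
  then show ?thesis by (auto simp: Legendre_def split: if_splits)
qed

text \<open>If \<open>p\<close> is odd and does not divide \<open>c\<close>, dividing by
  \<open>c\<close> modulo \<open>p\<close> makes (2 d - c) / c a square root of 5. Once
  \<open>p\<close> divides \<open>c\<close>, only \<open>d\<^sup>2\<close> is left of the form. For
  p = 2 the form is odd unless \<open>c\<close> and \<open>d\<close> are both even.\<close>

lemma golden_form_anisotropic_int:
  fixes c d :: int
  assumes p: "prime p" and mod5: "[p = 2] (mod 5) \<or> [p = 3] (mod 5)"
    and dvd: "int p dvd d\<^sup>2 - c * d - c\<^sup>2"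
  shows "int p dvd c \<and> int p dvd d"
proof (cases "p = 2")
  case True
  then have "even (d\<^sup>2 - c * d - c\<^sup>2)" using dvd by simp
  then have "even c \<and> even d" by (simp; blast)
  then show ?thesis using True by simp
next
  case False
  then have p2: "2 < p" using prime_ge_2_nat[OF p] by simp
  have pi: "prime (int p)" using p by simp
  have "int p dvd c"
  proof (rule ccontr)
    assume "\<not> int p dvd c"
    then have "coprime c (int p)" using pi prime_imp_coprime coprime_commute by blast
    then obtain e where e: "[c * e = 1] (mod int p)" using cong_solve_coprime_int by blast
    \<comment> \<open>completing the square: \<open>4 (d\<^sup>2 - c d - c\<^sup>2) = (2 d - c)\<^sup>2 - 5 c\<^sup>2\<close>\<close>
    have "[(2 * d - c)\<^sup>2 = 5 * c\<^sup>2] (mod int p)"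
      using dvd_mult[OF dvd, of 4] by (simp add: cong_iff_dvd_diff power2_eq_square algebra_simps)
    then have "[(2 * d - c)\<^sup>2 * e\<^sup>2 = 5 * c\<^sup>2 * e\<^sup>2] (mod int p)" by (rule cong_mult) simp
    moreover have "[5 * (c * e)\<^sup>2 = 5 * 1\<^sup>2] (mod int p)"
      by (intro cong_mult cong_pow e cong_refl)
    ultimately have "[((2 * d - c) * e)\<^sup>2 = 5] (mod int p)"
      by (simp add: power_mult_distrib mult.assoc) (metis cong_trans)
    then show False using not_QuadRes_5[OF p p2 mod5] by (auto simp: QuadRes_def)
  qed
  moreover have "int p dvd d"
  proof -
    have "int p dvd d\<^sup>2 - c * (d + c)" using dvd by (simp add: power2_eq_square algebra_simps)
    then have "int p dvd d\<^sup>2" using \<open>int p dvd c\<close> by (metis dvd_diff_right_iff dvd_mult2 dvd_diff_commute)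
    then show ?thesis using pi prime_dvd_power by blast
  qed
  ultimately show ?thesis ..
qed

lemma golden_form_anisotropic:
  fixes c d :: "'p::prime_card mod_ring"
  assumes mod5: "[CARD('p) = 2] (mod 5) \<or> [CARD('p) = 3] (mod 5)"
    and form: "d\<^sup>2 - c * d - c\<^sup>2 = 0"
  shows "c = 0 \<and> d = 0"
proof -
  define c' d' where "c' = to_int_mod_ring c" and "d' = to_int_mod_ring d"
  have cd: "c = of_int c'" "d = of_int d'" 
    unfolding c'_def d'_def of_int_of_int_mod_ring by simp_all
  \<comment> \<open>The characteristic of the prime field is \<open>CARD('p)\<close>, so vanishing
    in the field is divisibility of the integer representative.\<close>
  have iff: "(of_int n = (0 :: 'p mod_ring)) \<longleftrightarrow> int CARD('p) dvd n" for n
    using of_int_eq_iff_cong_CHAR[of n 0, where 'a = "'p mod_ring"] by (simp add: cong_0_iff)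
  have "of_int (d'\<^sup>2 - c' * d' - c'\<^sup>2) = (0 :: 'p mod_ring)"
    using form by (simp add: cd)
  then show ?thesis
    using golden_form_anisotropic_int[OF prime_card mod5, of d' c'] unfolding cd iff by blast
qed

text \<open>The equations say that the row vector (a, b) annihilates the block with rows (d, c) and
  (c + d, d), whose determinant is the anisotropic form.\<close>

lemma two_by_two_kernel_trivial:
  fixes a b c d :: "'p::prime_card mod_ring"
  assumes mod5: "[CARD('p) = 2] (mod 5) \<or> [CARD('p) = 3] (mod 5)"
    and eqs: "a * d + b * (c + d) = 0" "a * c + b * d = 0"
    and ne: "c \<noteq> 0 \<or> d \<noteq> 0"
  shows "a = 0 \<and> b = 0"
proof -
  have nz: "d\<^sup>2 - c * d - c\<^sup>2 \<noteq> 0" using golden_form_anisotropic[OF mod5] ne by blast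
  \<comment> \<open>Multiplication by the adjugate of the block, which gives the determinant times
    (a, b).\<close>
  have "a * (d\<^sup>2 - c * d - c\<^sup>2) = (a * d + b * (c + d)) * d - (a * c + b * d) * (c + d)"
    "b * (d\<^sup>2 - c * d - c\<^sup>2) = (a * c + b * d) * d - (a * d + b * (c + d)) * c"
    by (simp_all add: power2_eq_square algebra_simps)
  then show ?thesis using eqs nz by simp
qed

section \<open>Zero-dimensional subspaces and coordinates over the prime field\<close>

lemma subspace_dim_eq_0_iff:
  fixes W :: "'a::field vec set"
  assumes W: "subspace class_ring W (module_vec TYPE('a) n)" and fin: "finite W"
  shows "subspace_dim n W = 0 \<longleftrightarrow> W = {0\<^sub>v n}"
proof -
  interpret V: vec_space "TYPE('a)" n .
  interpret W: vectorspace class_ring "(module_vec TYPE('a) n)\<lparr>carrier := W\<rparr>"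
    by (rule V.subspace_is_vs[OF W])
  let ?V = "(module_vec TYPE('a) n)\<lparr>carrier := W\<rparr>"
  have zero: "zero ?V = 0\<^sub>v n" by (simp add: module_vec_def)
  show ?thesis
  proof
    assume dim0: "subspace_dim n W = 0"
    \<comment> \<open>\<open>dim\<close> is a least cardinality of finite generating sets; the
      finite set \<open>W\<close> generates itself, so the minimum is attained. At dimension 0 the
      minimal generating set is empty.\<close>
    have "\<exists>m A. finite A \<and> card A = m \<and> A \<subseteq> carrier ?V \<and> W.gen_set A"
      using fin W.in_own_span[of W] W.span_is_subset2[of W] by auto
    then have "\<exists>A. finite A \<and> card A = W.dim \<and> A \<subseteq> carrier ?V \<and> W.gen_set A"
      unfolding W.dim_def by (rule LeastI_ex)
    then have "W.gen_set {}" using dim0 by (auto simp: subspace_dim_def)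
    then show "W = {0\<^sub>v n}" by (simp add: W.span_empty zero)
  next
    assume "W = {0\<^sub>v n}"
    then have "W.gen_set {\<zero>\<^bsub>?V\<^esub>}"
      using W.span_zero W.span_is_subset2[of "{\<zero>\<^bsub>?V\<^esub>}"] by (auto simp: zero)
    then show "subspace_dim n W = 0" by (simp add: subspace_dim_def W.dim0I)
  qed
qed

lemma subspace_Int:
  assumes "subspace K A V" "subspace K B V"
  shows "subspace K (A \<inter> B) V"
  using assms unfolding subspace_def submodule_def by auto

text \<open>Every element has the form c + d \<omega> by spanning, and \<open>gf_coord_eq\<close>
  recovers \<open>c\<close> and \<open>d\<close> from it.\<close>

lemma gf_coord_inject:
  fixes x y :: "'f::field"
  assumes card: "CARD('f) = CARD('p::prime_card) ^ 2" and basis: "gf_basis TYPE('p) {1, \<omega>}"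
    and eq: "gf_coord \<omega> x 1 = (gf_coord \<omega> y 1 :: 'p mod_ring)"
      "gf_coord \<omega> x \<omega> = (gf_coord \<omega> y \<omega> :: 'p mod_ring)"
  shows "x = y"
proof -
  interpret F: vector_space "gf_scale :: 'p mod_ring \<Rightarrow> 'f \<Rightarrow> 'f"
    by (rule vector_space_gf_scale[OF card])
  have rep: "\<exists>(c :: 'p mod_ring) (d :: 'p mod_ring). z = gf_emb c + gf_emb d * \<omega>" for z
  proof -
    have "z \<in> F.span {1, \<omega>}" using basis by (auto simp: gf_basis_def)
    then obtain c d :: "'p mod_ring" where "z - gf_scale c 1 = gf_scale d \<omega>"
      by (auto simp: F.span_insert)
    then have "z = gf_emb c + gf_emb d * \<omega>" by (simp add: gf_scale_def diff_eq_eq)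
    then show ?thesis by blast
  qed
  obtain c d c' d' :: "'p mod_ring" where "x = gf_emb c + gf_emb d * \<omega>" "y = gf_emb c' + gf_emb d' * \<omega>"
    using rep by blast
  then show ?thesis using eq by (simp add: gf_coord_eq[OF card basis])
qed


section \<open>Row spaces of two-row matrices and the vectors in a vertex\<close>

text \<open>Replaces spans by entrywise equations: the two coefficients form the vector to which the
  transpose is applied.\<close>

lemma row_space_two_rows:
  fixes A :: "'a::field mat"
  assumes A: "A \<in> carrier_mat 2 n"
  shows "vec_space.row_space n A =
    {w \<in> carrier_vec n. \<exists>a b. \<forall>j<n. w $ j = a * A $$ (0, j) + b * A $$ (1, j)}"
proof -
  interpret V: vec_space "TYPE('a)" n .
  have mult: "(A\<^sup>T *\<^sub>v y) $ j = y $ 0 * A $$ (0, j) + y $ 1 * A $$ (1, j)"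
    if "j < n" "y \<in> carrier_vec 2" for j y
    using A that by (simp add: scalar_prod_def numeral_2_eq_2 mult.commute)
  have iff: "(\<exists>y\<in>carrier_vec 2. A\<^sup>T *\<^sub>v y = w) \<longleftrightarrow>
      (\<exists>a b. \<forall>j<n. w $ j = a * A $$ (0, j) + b * A $$ (1, j))" (is "?L \<longleftrightarrow> ?R")
    if w: "w \<in> carrier_vec n" for w
  proof
    assume ?L
    then show ?R using mult by metis
  next
    assume ?R
    then obtain a b where ab: "\<And>j. j < n \<Longrightarrow> w $ j = a * A $$ (0, j) + b * A $$ (1, j)" by auto
    define y where "y = vec 2 (\<lambda>i. if i = 0 then a else b)"
    have "A\<^sup>T *\<^sub>v y = w"
      using A w ab by (intro eq_vecI) (auto simp: mult y_def simp del: index_mult_mat_vec)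
    moreover have "y \<in> carrier_vec 2" by (simp add: y_def)
    ultimately show ?L by blast
  qed
  have "vec_space.row_space n A = {w \<in> carrier_vec n. \<exists>y\<in>carrier_vec 2. A\<^sup>T *\<^sub>v y = w}"
    using A V.row_space_eq[OF A] by simp
  also have "\<dots> = {w \<in> carrier_vec n. \<exists>a b. \<forall>j<n. w $ j = a * A $$ (0, j) + b * A $$ (1, j)}"
    by (rule Collect_cong) (rule conj_cong[OF refl iff])
  finally show ?thesis .
qed

text \<open>Here \<open>i\<close> is read off as \<open>dim_vec x\<close>; the empty vector gives the extra vertex \<open>H2\<close>.\<close>

definition gen_mat :: "'f::field \<Rightarrow> nat \<Rightarrow> 'f vec \<Rightarrow> 'p::prime_card mod_ring mat" where
  "gen_mat \<omega> r x = hcat (0\<^sub>m 2 (2 * r - 2 * dim_vec x)) (hcat (1\<^sub>m 2) (phi_O \<omega> x))"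

definition vertex :: "'f::field \<Rightarrow> nat \<Rightarrow> 'f vec \<Rightarrow> 'p::prime_card mod_ring vec set" where
  "vertex \<omega> r x = vec_space.row_space (2 * r + 2) (gen_mat \<omega> r x)"

lemma dim_phi_O [simp]: "dim_row (phi_O \<omega> x) = 2" "dim_col (phi_O \<omega> x) = 2 * dim_vec x"
  by (simp_all add: phi_O_def)

lemma gen_mat_carrier:
  fixes \<omega> :: "'f::field"
  assumes "dim_vec x \<le> r"
  shows "(gen_mat \<omega> r x :: 'p::prime_card mod_ring mat) \<in> carrier_mat 2 (2 * r + 2)"
  using assms by (intro carrier_matI) (simp_all add: gen_mat_def hcat_def)

lemma gen_mat_index:
  fixes \<omega> :: "'f::field"
  assumes "dim_vec x \<le> r" "k < 2" "j < 2 * r + 2"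
  shows "(gen_mat \<omega> r x $$ (k, j) :: 'p::prime_card mod_ring) =
    (let s = 2 * r - 2 * dim_vec x in
     if j < s then 0 else if j < s + 2 then (if j - s = k then 1 else 0)
     else phi_O \<omega> x $$ (k, j - s - 2))"
  using assms by (auto simp: gen_mat_def hcat_def Let_def)

text \<open>The identity block in columns \<open>s\<close> and \<open>s + 1\<close> exposes the two
  coefficients of a vector as its own entries there. They determine all other entries, through the
  two columns that each entry of \<open>x\<close> contributes to \<open>phi_O\<close>.\<close>

lemma vertex_coords:
  fixes \<omega> :: "'f::field" and w :: "'p::prime_card mod_ring vec"
  assumes x: "dim_vec x \<le> r" and w: "w \<in> vertex \<omega> r x"
  defines "s \<equiv> 2 * r - 2 * dim_vec x"
  shows "w \<in> carrier_vec (2 * r + 2)"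
    and "j < s \<Longrightarrow> w $ j = 0"
    and "m < dim_vec x \<Longrightarrow> w $ (s + 2 + 2 * m) =
      w $ s * gf_coord \<omega> (x $ m) \<omega> + w $ (s + 1) * (gf_coord \<omega> (x $ m) 1 + gf_coord \<omega> (x $ m) \<omega>)"
    and "m < dim_vec x \<Longrightarrow> w $ (s + 3 + 2 * m) =
      w $ s * gf_coord \<omega> (x $ m) 1 + w $ (s + 1) * gf_coord \<omega> (x $ m) \<omega>"
    and "w $ s = 0 \<Longrightarrow> w $ (s + 1) = 0 \<Longrightarrow> w = 0\<^sub>v (2 * r + 2)"
proof -
  let ?M = "gen_mat \<omega> r x :: 'p mod_ring mat"
  obtain a b where wc: "w \<in> carrier_vec (2 * r + 2)"
    and ab: "\<And>j. j < 2 * r + 2 \<Longrightarrow> w $ j = a * ?M $$ (0, j) + b * ?M $$ (1, j)"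
    using w unfolding vertex_def row_space_two_rows[OF gen_mat_carrier[OF x]] by blast
  show "w \<in> carrier_vec (2 * r + 2)" by (rule wc)
  have s: "s + 2 * dim_vec x = 2 * r" using x by (simp add: s_def)
  have M: "?M $$ (k, j) = (if j < s then 0 else if j < s + 2 then (if j - s = k then 1 else 0)
     else phi_O \<omega> x $$ (k, j - s - 2))" if "k < 2" "j < 2 * r + 2" for k j
    unfolding gen_mat_index[OF x that] s_def Let_def ..
  have a: "w $ s = a" and b: "w $ (s + 1) = b" using s by (simp_all add: ab M)
  show "w $ j = 0" if "j < s" using that s by (simp add: ab M)
  show "w $ (s + 2 + 2 * m) =
      w $ s * gf_coord \<omega> (x $ m) \<omega> + w $ (s + 1) * (gf_coord \<omega> (x $ m) 1 + gf_coord \<omega> (x $ m) \<omega>)"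
    if "m < dim_vec x" unfolding a b using that s by (simp add: ab M phi_O_def)
  show "w $ (s + 3 + 2 * m) =
      w $ s * gf_coord \<omega> (x $ m) 1 + w $ (s + 1) * gf_coord \<omega> (x $ m) \<omega>"
    if "m < dim_vec x"
  proof -
    \<comment> \<open>Behind the zero and identity blocks this is the odd column 2 m + 1 of
      \<open>phi_O\<close>, the second one belonging to entry \<open>m\<close>.\<close>
    have "s + 3 + 2 * m - s - 2 = 2 * m + 1" "(2 * m + 1) div 2 = m" by simp_all
    then show ?thesis unfolding a b using that s by (simp add: ab M phi_O_def del: div_mult_self1)
  qed
  show "w = 0\<^sub>v (2 * r + 2)" if "w $ s = 0" "w $ (s + 1) = 0"
    using that wc unfolding a b by (intro eq_vecI) (auto simp: ab)
qed

lemma zero_in_vertex: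
  fixes \<omega> :: "'f::field"
  assumes "dim_vec x \<le> r"
  shows "0\<^sub>v (2 * r + 2) \<in> (vertex \<omega> r x :: 'p::prime_card mod_ring vec set)"
  unfolding vertex_def row_space_two_rows[OF gen_mat_carrier[OF assms]]
  by (auto intro!: exI[of _ 0])

text \<open>The first generator row has a 1 at the start of the identity block. This makes a vertex
  meet itself nontrivially, which excludes loops.\<close>

lemma vertex_ne_zero:
  fixes \<omega> :: "'f::field"
  assumes x: "dim_vec x \<le> r"
  shows "(vertex \<omega> r x :: 'p::prime_card mod_ring vec set) \<noteq> {0\<^sub>v (2 * r + 2)}"
proof -
  let ?M = "gen_mat \<omega> r x :: 'p mod_ring mat"
  let ?s = "2 * r - 2 * dim_vec x"
  have M: "?M \<in> carrier_mat 2 (2 * r + 2)" by (rule gen_mat_carrier[OF x])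
  have "\<forall>j<2 * r + 2. row ?M 0 $ j = 1 * ?M $$ (0, j) + 0 * ?M $$ (1, j)"
    using M by auto
  moreover have "row ?M 0 \<in> carrier_vec (2 * r + 2)" using M by (rule row_carrier_vec[rotated]) simp
  ultimately have "row ?M 0 \<in> vertex \<omega> r x"
    unfolding vertex_def row_space_two_rows[OF M] by blast
  moreover have "row ?M 0 $ ?s = 1"
    using M gen_mat_index[OF x, of 0 ?s \<omega>, where 'p = 'p] by auto
  then have "row ?M 0 \<noteq> 0\<^sub>v (2 * r + 2)" by (auto dest!: arg_cong[of _ _ "\<lambda>v. v $ ?s"])
  ultimately show ?thesis by blast
qed

lemma vertex_Int_trivial:
  fixes \<omega> :: "'f::field"
  assumes card: "CARD('f) = CARD('p::prime_card) ^ 2" and basis: "gf_basis TYPE('p) {1, \<omega>}"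
    and mod5: "[CARD('p) = 2] (mod 5) \<or> [CARD('p) = 3] (mod 5)"
    and x: "dim_vec x \<le> r" and y: "dim_vec y \<le> r" and ne: "x \<noteq> y"
  shows "vertex \<omega> r x \<inter> vertex \<omega> r y = {0\<^sub>v (2 * r + 2) :: 'p mod_ring vec}"
proof -
  have shorter: "w = 0\<^sub>v (2 * r + 2)"
    if "dim_vec u < dim_vec v" "dim_vec v \<le> r" "w \<in> vertex \<omega> r u" "w \<in> vertex \<omega> r v"
    for u v and w :: "'p mod_ring vec"
    \<comment> \<open>The longer vector \<open>v\<close> has its identity block at least two columns
      further left, so both of its columns lie where all vectors of the vertex of \<open>u\<close>
      vanish.\<close>
    by (rule vertex_coords(5)[OF that(2,4)]; rule vertex_coords(2)[OF _ that(3)]) (use that in auto)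
  have same: "w = 0\<^sub>v (2 * r + 2)"
    if dims: "dim_vec x = dim_vec y" and wx: "w \<in> vertex \<omega> r x" and wy: "w \<in> vertex \<omega> r y"
    for w :: "'p mod_ring vec"
  proof -
    obtain m where m: "m < dim_vec x" "x $ m \<noteq> y $ m" using ne dims by (metis eq_vecI)
    let ?s = "2 * r - 2 * dim_vec x"
    let ?c = "gf_coord \<omega> (x $ m) 1 - gf_coord \<omega> (y $ m) 1 :: 'p mod_ring"
    let ?d = "gf_coord \<omega> (x $ m) \<omega> - gf_coord \<omega> (y $ m) \<omega> :: 'p mod_ring"
    have "?c \<noteq> 0 \<or> ?d \<noteq> 0" using gf_coord_inject[OF card basis] m(2) by auto
    \<comment> \<open>Both parametrizations give the same entry of \<open>w\<close> with the same
      two coefficients; subtracting them leaves a kernel equation for the difference block.\<close>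
    moreover have "w $ ?s * ?d + w $ (?s + 1) * (?c + ?d) = 0"
      using vertex_coords(3)[OF x wx m(1)] vertex_coords(3)[OF y wy, of m] m(1) dims
      by (simp add: algebra_simps)
    moreover have "w $ ?s * ?c + w $ (?s + 1) * ?d = 0"
      using vertex_coords(4)[OF x wx m(1)] vertex_coords(4)[OF y wy, of m] m(1) dims
      by (simp add: algebra_simps)
    ultimately have "w $ ?s = 0 \<and> w $ (?s + 1) = 0"
      by (intro two_by_two_kernel_trivial[OF mod5, of _ ?d _ ?c])
    then show ?thesis using vertex_coords(5)[OF x wx] by simp
  qed
  have "w = 0\<^sub>v (2 * r + 2)" if "w \<in> vertex \<omega> r x" "w \<in> vertex \<omega> r y" for w :: "'p mod_ring vec"
    using shorter[OF _ y that] same[OF _ that] shorter[OF _ x that(2,1)] by linarith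
  then show ?thesis using zero_in_vertex[OF x] zero_in_vertex[OF y] by blast
qed

lemma subspace_vertex:
  fixes \<omega> :: "'f::field"
  assumes x: "dim_vec x \<le> r"
  shows "subspace class_ring (vertex \<omega> r x) (module_vec TYPE('p::prime_card mod_ring) (2 * r + 2))"
proof -
  interpret V: vec_space "TYPE('p mod_ring)" "2 * r + 2" .
  have "set (rows (gen_mat \<omega> r x :: 'p mod_ring mat)) \<subseteq> carrier_vec (2 * r + 2)"
    using gen_mat_carrier[OF x, of \<omega>, where 'p = 'p] by (auto simp: rows_def)
  then show ?thesis
    unfolding vertex_def V.row_space_def by (intro V.span_is_subspace) simp
qed

section \<open>Parametrization of the vertex set and its count\<close>

lemma H2_eq_gen_mat: "H2 r = gen_mat \<omega> r (0\<^sub>v 0)"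
proof (rule eq_matI)
  fix i j assume "i < dim_row (gen_mat \<omega> r (0\<^sub>v 0))" "j < dim_col (gen_mat \<omega> r (0\<^sub>v 0))"
  then have ij: "i < 2" "j < 2 * r + 2" by (simp_all add: gen_mat_def hcat_def)
  then show "H2 r $$ (i, j) = gen_mat \<omega> r (0\<^sub>v 0) $$ (i, j)"
    by (subst gen_mat_index[OF _ ij]) (auto simp: H2_def hcat_def Let_def)
qed (simp_all add: H2_def gen_mat_def hcat_def)

lemma D_set_eq_vertex:
  fixes \<omega> :: "'f::field"
  shows "D_set \<omega> r i = (vertex \<omega> r ` carrier_vec i :: 'p::prime_card mod_ring vec set set)"
proof -
  have "(vertex \<omega> r x :: 'p mod_ring vec set) = vec_space.row_space (2 * r + 2) (hcat (0\<^sub>m 2 (2 * r - 2 * i)) (hcat (1\<^sub>m 2) (phi_O \<omega> x)))"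
    if "x \<in> carrier_vec i" for x
    using that by (simp only: vertex_def gen_mat_def carrier_vecD)
  then show ?thesis
    unfolding D_set_def Setcompr_eq_image image_image by (intro image_cong) simp_all
qed

text \<open>Sorting vectors by length matches the empty vector with \<open>H2\<close> and length i
  with \<open>D_set \<omega> r i\<close>.\<close>

lemma G_set_eq_vertex:
  fixes \<omega> :: "'f::field"
  shows "G_set \<omega> r = vertex \<omega> r ` {x. dim_vec x \<le> r}"
proof -
  have "{x :: 'f vec. dim_vec x \<le> r} = {(0\<^sub>v 0)} \<union> (\<Union>i\<in>{1..r}. carrier_vec i)"
  proof (rule Set.set_eqI)
    fix x :: "'f vec"
    have "dim_vec x \<le> r \<longleftrightarrow> dim_vec x = 0 \<or> (\<exists>i\<in>{1..r}. dim_vec x = i)"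
      by (auto simp: Suc_le_eq simp del: vec_of_dim_0)
    then show "x \<in> {x. dim_vec x \<le> r} \<longleftrightarrow> x \<in> {(0\<^sub>v 0)} \<union> (\<Union>i\<in>{1..r}. carrier_vec i)"
      by (simp only: mem_Collect_eq Un_iff UN_iff singleton_iff carrier_dim_vec vec_of_dim_0)
  qed
  then show ?thesis
    by (simp only: G_set_def image_Un image_UN D_set_eq_vertex H2_eq_gen_mat[of r \<omega>] vertex_def
        image_insert image_empty)
qed

text \<open>Vectors correspond to lists, whose number up to a given length is known.\<close>

lemma card_vec_dim_le:
  assumes fin: "finite (UNIV :: 'a set)"
  shows "finite {x :: 'a vec. dim_vec x \<le> r}"
    and "card {x :: 'a vec. dim_vec x \<le> r} = (\<Sum>i\<le>r. CARD('a) ^ i)"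
proof -
  have bij: "bij_betw vec_of_list {xs :: 'a list. set xs \<subseteq> UNIV \<and> length xs \<le> r} {x. dim_vec x \<le> r}"
    by (rule bij_betwI[where g = list_of_vec]) (auto simp: vec_list list_vec)
  show "finite {x :: 'a vec. dim_vec x \<le> r}"
    using bij_betw_finite[OF bij] finite_lists_length_le[OF fin] by simp
  show "card {x :: 'a vec. dim_vec x \<le> r} = (\<Sum>i\<le>r. CARD('a) ^ i)"
    using bij_betw_same_card[OF bij] card_lists_length_le[OF fin] by simp
qed

section \<open>Completeness of the graph and the number of its vertices\<close>

theorem mainTheorem5:
  fixes p r :: nat and \<omega> :: "'f::field"
  assumes "prime p" and "[p = 2] (mod 5) \<or> [p = 3] (mod 5)" and "r \<ge> 1"
    and "CARD('p::prime_card) = p" and "CARD('f) = p ^ 2"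
    and "gf_basis TYPE('p) {1, \<omega>}"
  shows "\<exists>n. complete_digraph n (with_proj (Gamma_graph \<omega> r :: 'p mod_ring vec set pair_pre_digraph)) \<and>
    real n = (real p ^ (2 * r + 2) - 1) / (real p ^ 2 - 1)"
proof -
  let ?X = "{x :: 'f vec. dim_vec x \<le> r}"
  let ?V = "vertex \<omega> r :: 'f vec \<Rightarrow> 'p mod_ring vec set"
  let ?G = "Gamma_graph \<omega> r :: 'p mod_ring vec set pair_pre_digraph"
  have card: "CARD('f) = CARD('p) ^ 2" and mod5: "[CARD('p) = 2] (mod 5) \<or> [CARD('p) = 3] (mod 5)"
    using assms by simp_all
  have p1: "p > 1" using \<open>prime p\<close> prime_gt_1_nat by blast
  have "finite (UNIV :: 'f set)"
    using assms(5) p1 by (intro card_ge_0_finite) simp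
  note X = card_vec_dim_le[OF this, of r]
  \<comment> \<open>For x = y the intersection is the vertex itself, which is not the zero space.
    Injectivity follows, since equal vertices have the same intersection with
    \<open>?V x\<close>.\<close>
  have Int: "?V x \<inter> ?V y = {0\<^sub>v (2 * r + 2)} \<longleftrightarrow> x \<noteq> y" if "x \<in> ?X" "y \<in> ?X" for x y
    using vertex_Int_trivial[OF card assms(6) mod5, of x r y] vertex_ne_zero[of x r \<omega>, where 'p = 'p] that
    by auto
  have inj: "inj_on ?V ?X"
  proof (rule inj_onI)
    fix x y assume "x \<in> ?X" "y \<in> ?X" "?V x = ?V y"
    then show "x = y" using Int[of x y] Int[of x x] by auto
  qed
  have adj: "subspace_dim (2 * r + 2) (?V x \<inter> ?V y) = 0 \<longleftrightarrow> ?V x \<noteq> ?V y"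
    if "x \<in> ?X" "y \<in> ?X" for x y
  proof -
    \<comment> \<open>The length bound places the vertex in a finite set, as the dimension criterion
      needs finite intersections.\<close>
    have "?V x \<subseteq> {w. dim_vec w \<le> 2 * r + 2}"
    proof
      fix w assume "w \<in> ?V x"
      with \<open>x \<in> ?X\<close> have "w \<in> carrier_vec (2 * r + 2)" by (intro vertex_coords(1)) simp_all
      then have "dim_vec w = 2 * r + 2" by (rule carrier_vecD)
      then show "w \<in> {w. dim_vec w \<le> 2 * r + 2}" by simp
    qed
    then have "finite (?V x \<inter> ?V y)"
      using finite_subset card_vec_dim_le(1)[OF finite] by blast
    then have "subspace_dim (2 * r + 2) (?V x \<inter> ?V y) = 0 \<longleftrightarrow> ?V x \<inter> ?V y = {0\<^sub>v (2 * r + 2)}"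
      using that by (intro subspace_dim_eq_0_iff subspace_Int subspace_vertex) auto
    also have "\<dots> \<longleftrightarrow> ?V x \<noteq> ?V y" using Int[OF that] inj that by (auto dest: inj_onD)
    finally show ?thesis .
  qed
  have verts: "pverts ?G = ?V ` ?X" by (simp add: Gamma_graph_def G_set_eq_vertex)
  \<comment> \<open>Adjacency coincides with inequality, so all pairs of distinct vertices are
    joined and no loops occur.\<close>
  have "parcs ?G = {(A, B). (A, B) \<in> pverts ?G \<times> pverts ?G \<and> A \<noteq> B}"
    unfolding verts using adj by (auto simp: Gamma_graph_def G_set_eq_vertex)
  moreover have "card (pverts ?G) = (\<Sum>i\<le>r. (p\<^sup>2) ^ i)"
    unfolding verts card_image[OF inj] X(2) assms(5) ..
  moreover have "finite (pverts ?G)" unfolding verts using X(1) by simp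
  ultimately have "complete_digraph (\<Sum>i\<le>r. (p\<^sup>2) ^ i) (with_proj ?G)"
    unfolding complete_digraph_pair_def by blast
  moreover have "real (\<Sum>i\<le>r. (p\<^sup>2) ^ i) = (real p ^ (2 * r + 2) - 1) / (real p ^ 2 - 1)"
  proof -
    have "real p ^ 2 \<noteq> 1" using p1 by (simp add: power2_eq_1_iff)
    \<comment> \<open>Geometric series with ratio p^2 and r + 1 terms, the term i = 0 counting the
      vertex of \<open>H2\<close>.\<close>
    then have "(\<Sum>i<Suc r. (real p ^ 2) ^ i) = ((real p ^ 2) ^ Suc r - 1) / (real p ^ 2 - 1)"
      by (rule geometric_sum)
    moreover have "(real p ^ 2) ^ Suc r = real p ^ (2 * r + 2)" by (simp add: power2_eq_square power_mult_distrib power_add mult_2)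
    ultimately show ?thesis by (simp only: lessThan_Suc_atMost of_nat_sum of_nat_power)
  qed
  ultimately show ?thesis by blast
qed

end
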